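(* For each $\{1,3\}$-graph $G$, the polytope $4\mathcal{P}_G-\mathbf{1}=\{4w-\mathbf{1} : w\in\mathcal{P}_G\}$ is reflexive, where $\mathbf{1}=(1,\ldots,1)\in\mathbb{R}^m$ and $m$ is the number of edges of $G$.
   Context: Graphs are finite and may have loops and parallel edges; a loop contributes 2 to the degree. A $\{1,3\}$-graph is a graph whose vertices have degree either one or three. For a $\{1,3\}$-graph $G=(V,E)$ with $E=\{1,\ldots,m\}$, the polytope $\mathcal{P}_G\subseteq\mathbb{R}^m$ is the set of all $w=(w_1,\ldots,w_m)\in\mathbb{R}^m$ such that, for every degree three vertex $v$, with incident edges $a,b,c$ (a loop at $v$ being listed twice), $$w_a+w_b+w_c\le 1,\quad w_a\le w_b+w_c,\quad w_b\le w_a+w_c,\quad w_c\le w_a+w_b.$$ For a polytope $\mathcal{P}\subseteq\mathbb{R}^m$ and a real $s\ge0$, let $L_{\mathcal{P}}(s)=|s\mathcal{P}\cap\mathbb{Z}^m|$. The polytope $\mathcal{P}$ is semi-reflexive if $L_{\mathcal{P}}(s)=L_{\mathcal{P}}(\lfloor s\rfloor)$ for every nonnegative real $s$. A polytope is integral if all its vertices are in $\mathbb{Z}^m$. A polytope is reflexive if it is integral, the origin is in its interior, and it is semi-reflexive (equivalently, it is integral and of the form $\{x\in\mathbb{R}^m : Ax\le\mathbf{1}\}$ for some integral matrix $A$, where $\mathbf{1}$ here is the all-ones vector of the appropriate dimension).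
   Formalization: It is additionally assumed that every edge has an end of degree three (no component is a single edge joining two degree-one vertices); otherwise P_G is unbounded, hence no polytope, and the claim fails. The graph with no edges (m = 0) is also not covered. *)

theory Defs
  imports "HOL-Analysis.Analysis" "HOL-Library.Multiset"
begin

text \<open>
  Graphs with loops and parallel edges. The edges are all the elements of the type \<open>'e\<close>, so that
  \<open>\<real>\<^sup>m\<close> becomes \<^typ>\<open>real ^ 'e\<close> with \<open>m = CARD('e)\<close>. The two ends of an edge form a multiset,
  which is \<open>{#v, v#}\<close> for a loop at \<open>v\<close>.
\<close>

record ('v, 'e) multigraph =
  verts :: "'v set"
  ends :: "'e \<Rightarrow> 'v multiset"

definition finite_multigraph :: "('v, 'e::finite) multigraph \<Rightarrow> bool" where
  "finite_multigraph G \<longleftrightarrow>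
     finite (verts G) \<and> (\<forall>e. size (ends G e) = 2 \<and> set_mset (ends G e) \<subseteq> verts G)"

definition vertex_degree :: "('v, 'e::finite) multigraph \<Rightarrow> 'v \<Rightarrow> nat" where
  "vertex_degree G v = (\<Sum>e\<in>UNIV. count (ends G e) v)"

definition one_three_graph :: "('v, 'e::finite) multigraph \<Rightarrow> bool" where
  "one_three_graph G \<longleftrightarrow>
     finite_multigraph G \<and> (\<forall>v\<in>verts G. vertex_degree G v = 1 \<or> vertex_degree G v = 3)"

text \<open>The edges at \<open>v\<close>, with a loop listed twice.\<close>

definition incident :: "('v, 'e::finite) multigraph \<Rightarrow> 'v \<Rightarrow> 'e multiset" where
  "incident G v = (\<Sum>e\<in>UNIV. replicate_mset (count (ends G e) v) e)"

lemma size_incident: "size (incident G v) = vertex_degree G v"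
  by (simp add: incident_def vertex_degree_def size_multiset_sum)

lemma count_incident: "count (incident G v) e = count (ends G e) v"
  by (simp add: incident_def count_sum if_distrib cong: if_cong)

definition graph_polytope :: "('v, 'e::finite) multigraph \<Rightarrow> (real ^ 'e) set" where
  "graph_polytope G =
     {w. \<forall>v\<in>verts G. vertex_degree G v = 3 \<longrightarrow>
           (\<forall>a b c. incident G v = {#a, b, c#} \<longrightarrow>
              w $ a + w $ b + w $ c \<le> 1 \<and>
              w $ a \<le> w $ b + w $ c \<and>
              w $ b \<le> w $ a + w $ c \<and>
              w $ c \<le> w $ a + w $ b)}"

definition integer_points :: "(real ^ 'n) set" where
  "integer_points = {x. \<forall>i. x $ i \<in> \<int>}"

definition lattice_count :: "(real ^ 'n) set \<Rightarrow> real \<Rightarrow> nat" where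
  "lattice_count P s = card ((\<lambda>x. s *\<^sub>R x) ` P \<inter> integer_points)"

definition semi_reflexive :: "(real ^ 'n) set \<Rightarrow> bool" where
  "semi_reflexive P \<longleftrightarrow>
     polytope P \<and> (\<forall>s\<ge>0. lattice_count P s = lattice_count P (of_int \<lfloor>s\<rfloor>))"

definition integral_polytope :: "(real ^ 'n) set \<Rightarrow> bool" where
  "integral_polytope P \<longleftrightarrow>
     polytope P \<and> (\<forall>x. x extreme_point_of P \<longrightarrow> x \<in> integer_points)"

definition reflexive_polytope :: "(real ^ 'n) set \<Rightarrow> bool" where
  "reflexive_polytope P \<longleftrightarrow> integral_polytope P \<and> 0 \<in> interior P \<and> semi_reflexive P"

end

theory Submission
  imports Defs
begin

text \<open>
  In the coordinates \<open>x = 4w - 1\<close> the inequalities at a degree three vertex with incident edges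
  \<open>a\<close>, \<open>b\<close>, \<open>c\<close> become \<open>x\<^sub>a + x\<^sub>b + x\<^sub>c \<le> 1\<close>, \<open>x\<^sub>a - x\<^sub>b - x\<^sub>c \<le> 1\<close> and the two similar ones: all right-hand
  sides are \<open>1\<close> and all coefficients are integers. At each vertex they cut out the regular
  tetrahedron inscribed in the cube \<open>[-1,1]\<^sup>3\<close>, and since every edge has a degree three end, the
  whole polyhedron lies in the cube \<open>[-1,1]\<^sup>m\<close>. A bounded set of the form \<open>{x. A x \<le> 1}\<close> with \<open>A\<close>
  integral is semi-reflexive with the origin in its interior, because an integer is at most \<open>s\<close> iff
  it is at most \<open>\<lfloor>s\<rfloor>\<close> (\<open>semi_reflexive_unit_polyhedron\<close>).

  Integrality is the substance. Let \<open>x\<close> be a point of the polyhedron and let \<open>F\<close> be the set of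
  edges \<open>e\<close> with \<open>\<bar>x\<^sub>e\<bar> < 1\<close>; look for a nonzero direction \<open>d\<close> supported on \<open>F\<close> that keeps every tight
  inequality tight. A point of the tetrahedron is either one of its four corners, so that no edge
  of \<open>F\<close> arrives at the vertex, or it lies inside one of the six sides, where exactly one
  coordinate is \<open>\<plusminus>1\<close>, or it lies on at most one facet. In the last two cases a single linear
  equation on \<open>d\<close> is enough to preserve tightness at that vertex (\<open>tetrahedron_local_equation\<close>), and
  the vertex receives two or three ends of edges of \<open>F\<close>. Counting ends, there are at most \<open>|F|\<close>
  equations on the \<open>|F|\<close> unknowns. If there are fewer, a nonzero solution exists. If there are
  exactly \<open>|F|\<close>, then every vertex involved is of the side type, where the equation is
  \<open>d\<^sub>a = \<plusminus>d\<^sub>b\<close> with the very sign for which \<open>x\<^sub>a = \<plusminus>x\<^sub>b\<close>; hence the restriction of \<open>x\<close> to \<open>F\<close> is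
  itself a solution, and it is nonzero unless \<open>x\<close> is integral. So an extreme point, from which no such
  direction leaves, is integral (\<open>tight_direction\<close>, \<open>not_extreme_point_if_tight_direction\<close>).
\<close>

section \<open>Polyhedra given by inequalities with right-hand side one\<close>

definition unit_polyhedron :: "(real ^ 'n) set \<Rightarrow> (real ^ 'n) set" where
  "unit_polyhedron A = {x. \<forall>n\<in>A. n \<bullet> x \<le> 1}"

lemma polytope_unit_polyhedron:
  assumes "finite A" "bounded (unit_polyhedron A)"
  shows "polytope (unit_polyhedron A)"
proof -
  have "unit_polyhedron A = \<Inter> ((\<lambda>n. {x. n \<bullet> x \<le> 1}) ` A)"
    by (auto simp: unit_polyhedron_def)
  moreover have "polyhedron (\<Inter> ((\<lambda>n. {x. n \<bullet> x \<le> 1}) ` A))"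
    using assms(1) by (intro polyhedron_Inter) (auto simp: polyhedron_halfspace_le)
  ultimately show ?thesis
    using assms(2) by (simp add: polytope_eq_bounded_polyhedron)
qed

lemma zero_in_interior_unit_polyhedron:
  assumes "finite A"
  shows "0 \<in> interior (unit_polyhedron A)"
proof (rule interiorI)
  show "open (\<Inter>n\<in>A. {x. n \<bullet> x < 1})"
    using assms by (intro open_INT) (auto simp: open_halfspace_lt)
  show "0 \<in> (\<Inter>n\<in>A. {x. n \<bullet> x < 1})" by simp
  show "(\<Inter>n\<in>A. {x. n \<bullet> x < 1}) \<subseteq> unit_polyhedron A"
    by (auto simp: unit_polyhedron_def intro: less_imp_le)
qed

text \<open>
  For \<open>s = 0\<close> the claim is that the recession cone is trivial, which is where boundedness enters.
\<close>

lemma scale_unit_polyhedron: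
  assumes bdd: "bounded (unit_polyhedron A)" and s: "s \<ge> 0"
  shows "(\<lambda>x. s *\<^sub>R x) ` unit_polyhedron A = {x. \<forall>n\<in>A. n \<bullet> x \<le> s}"
proof (cases "s = 0")
  case True
  have "x = 0" if x: "\<forall>n\<in>A. n \<bullet> x \<le> 0" for x
  proof (rule ccontr)
    assume "x \<noteq> 0"
    obtain B where B: "\<And>y. y \<in> unit_polyhedron A \<Longrightarrow> norm y \<le> B"
      using bdd by (auto simp: bounded_iff)
    define t where "t = (\<bar>B\<bar> + 1) / norm x"
    have "t \<ge> 0" by (simp add: t_def)
    hence "n \<bullet> (t *\<^sub>R x) \<le> 1" if "n \<in> A" for n
    proof -
      have "t * (n \<bullet> x) \<le> 0"
        using x that \<open>t \<ge> 0\<close> by (simp add: mult_nonneg_nonpos)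
      thus ?thesis by simp
    qed
    hence "norm (t *\<^sub>R x) \<le> B" by (intro B) (simp add: unit_polyhedron_def)
    thus False using \<open>x \<noteq> 0\<close> by (simp add: t_def)
  qed
  moreover have "0 \<in> unit_polyhedron A" by (simp add: unit_polyhedron_def)
  ultimately show ?thesis using True by auto
next
  case False
  hence s: "s > 0" using s by simp
  show ?thesis
  proof (intro set_eqI iffI)
    fix x assume "x \<in> (\<lambda>x. s *\<^sub>R x) ` unit_polyhedron A"
    thus "x \<in> {x. \<forall>n\<in>A. n \<bullet> x \<le> s}"
      using s by (auto simp: unit_polyhedron_def mult_le_cancel_left1)
  next
    fix x assume "x \<in> {x. \<forall>n\<in>A. n \<bullet> x \<le> s}"
    hence "(1 / s) *\<^sub>R x \<in> unit_polyhedron A"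
      using s by (auto simp: unit_polyhedron_def field_simps)
    moreover have "x = s *\<^sub>R ((1 / s) *\<^sub>R x)" using s by simp
    ultimately show "x \<in> (\<lambda>x. s *\<^sub>R x) ` unit_polyhedron A" by (rule rev_image_eqI)
  qed
qed

lemma inner_integer_points:
  assumes "x \<in> integer_points" "y \<in> integer_points"
  shows "x \<bullet> y \<in> \<int>"
  using assms by (auto simp: inner_vec_def integer_points_def intro!: Ints_sum Ints_mult)

lemma semi_reflexive_unit_polyhedron:
  assumes fin: "finite A" and bdd: "bounded (unit_polyhedron A)" and int: "A \<subseteq> integer_points"
  shows "semi_reflexive (unit_polyhedron A)"
proof -
  have "lattice_count (unit_polyhedron A) s = lattice_count (unit_polyhedron A) (of_int \<lfloor>s\<rfloor>)"
    if s: "s \<ge> 0" for s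
  proof -
    have "(\<forall>n\<in>A. n \<bullet> x \<le> s) \<longleftrightarrow> (\<forall>n\<in>A. n \<bullet> x \<le> of_int \<lfloor>s\<rfloor>)" if "x \<in> integer_points" for x
    proof (intro ball_cong refl)
      fix n assume "n \<in> A"
      hence "n \<bullet> x \<in> \<int>" using int that by (auto intro: inner_integer_points)
      then obtain k where "n \<bullet> x = of_int k" by (auto elim: Ints_cases)
      thus "(n \<bullet> x \<le> s) = (n \<bullet> x \<le> of_int \<lfloor>s\<rfloor>)" by (simp add: le_floor_iff)
    qed
    hence "{x. \<forall>n\<in>A. n \<bullet> x \<le> s} \<inter> integer_points
         = {x. \<forall>n\<in>A. n \<bullet> x \<le> of_int \<lfloor>s\<rfloor>} \<inter> integer_points"
      by blast
    thus ?thesis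
      using s by (simp add: lattice_count_def scale_unit_polyhedron[OF bdd])
  qed
  thus ?thesis using polytope_unit_polyhedron[OF fin bdd] unfolding semi_reflexive_def by blast
qed

text \<open>
  The finitely many inequalities that are not tight at \<open>x\<close> have positive slack, so a sufficiently
  short step along \<open>d\<close> in either direction respects them, and \<open>x\<close> is the midpoint of a segment.
\<close>

lemma not_extreme_point_if_tight_direction:
  assumes fin: "finite A" and x: "x \<in> unit_polyhedron A" and "d \<noteq> 0"
    and tight: "\<And>n. n \<in> A \<Longrightarrow> n \<bullet> x = 1 \<Longrightarrow> n \<bullet> d = 0"
  shows "\<not> x extreme_point_of unit_polyhedron A"
proof
  assume ext: "x extreme_point_of unit_polyhedron A"
  have "\<exists>\<epsilon>>0. \<forall>n\<in>A. \<epsilon> * \<bar>n \<bullet> d\<bar> \<le> 1 - n \<bullet> x"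
    using fin x tight
  proof (induction A rule: finite_induct)
    case empty
    show ?case by (auto intro: exI[of _ 1])
  next
    case (insert n A)
    obtain \<epsilon> where \<epsilon>: "\<epsilon> > 0" "\<And>k. k \<in> A \<Longrightarrow> \<epsilon> * \<bar>k \<bullet> d\<bar> \<le> 1 - k \<bullet> x"
      using insert by (auto simp: unit_polyhedron_def)
    have n: "n \<bullet> x \<le> 1" using insert.prems by (simp add: unit_polyhedron_def)
    have "\<exists>\<delta>>0. \<delta> * \<bar>n \<bullet> d\<bar> \<le> 1 - n \<bullet> x"
    proof (cases "n \<bullet> d = 0")
      case True
      thus ?thesis using n by (auto intro: exI[of _ 1])
    next
      case False
      hence "n \<bullet> x < 1" using n insert.prems(2)[of n] by force
      thus ?thesis using False by (intro exI[of _ "(1 - n \<bullet> x) / \<bar>n \<bullet> d\<bar>"]) simp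
    qed
    then obtain \<delta> where \<delta>: "\<delta> > 0" "\<delta> * \<bar>n \<bullet> d\<bar> \<le> 1 - n \<bullet> x" by blast
    have "min \<epsilon> \<delta> * \<bar>k \<bullet> d\<bar> \<le> 1 - k \<bullet> x" if "k \<in> insert n A" for k
    proof -
      have "min \<epsilon> \<delta> * \<bar>k \<bullet> d\<bar> \<le> (if k = n then \<delta> else \<epsilon>) * \<bar>k \<bullet> d\<bar>"
        by (intro mult_right_mono) auto
      also have "\<dots> \<le> 1 - k \<bullet> x" using that \<epsilon> \<delta> by auto
      finally show ?thesis .
    qed
    thus ?case using \<epsilon>(1) \<delta>(1) by (intro exI[of _ "min \<epsilon> \<delta>"]) auto
  qed
  then obtain \<epsilon> where \<epsilon>: "\<epsilon> > 0" "\<And>n. n \<in> A \<Longrightarrow> \<epsilon> * \<bar>n \<bullet> d\<bar> \<le> 1 - n \<bullet> x" by blast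
  have step: "x + t *\<^sub>R d \<in> unit_polyhedron A" if "\<bar>t\<bar> = \<epsilon>" for t
  proof -
    have "n \<bullet> (x + t *\<^sub>R d) \<le> 1" if "n \<in> A" for n
    proof -
      have "t * (n \<bullet> d) \<le> \<epsilon> * \<bar>n \<bullet> d\<bar>"
        using abs_ge_self[of "t * (n \<bullet> d)"] \<open>\<bar>t\<bar> = \<epsilon>\<close> by (simp add: abs_mult)
      thus ?thesis using \<epsilon>(2)[OF that] by (simp add: inner_add_right)
    qed
    thus ?thesis by (simp add: unit_polyhedron_def)
  qed
  have "x + \<epsilon> *\<^sub>R d \<in> unit_polyhedron A" "x + (- \<epsilon>) *\<^sub>R d \<in> unit_polyhedron A"
    using \<epsilon>(1) by (auto intro!: step simp del: scaleR_minus_left)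
  moreover have "x \<in> open_segment (x + \<epsilon> *\<^sub>R d) (x + (- \<epsilon>) *\<^sub>R d)"
  proof -
    have "(x + \<epsilon> *\<^sub>R d) + (x + (- \<epsilon>) *\<^sub>R d) = 2 *\<^sub>R x"
      by (simp add: scaleR_2)
    hence "x = midpoint (x + \<epsilon> *\<^sub>R d) (x + (- \<epsilon>) *\<^sub>R d)"
      unfolding midpoint_def by simp
    moreover have "x + \<epsilon> *\<^sub>R d \<noteq> x + (- \<epsilon>) *\<^sub>R d"
    proof
      assume "x + \<epsilon> *\<^sub>R d = x + (- \<epsilon>) *\<^sub>R d"
      hence "\<epsilon> = - \<epsilon>" using \<open>d \<noteq> 0\<close> by (simp only: add_left_cancel scaleR_cancel_right) simp
      thus False using \<epsilon>(1) by simp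
    qed
    ultimately show ?thesis by (metis midpoint_in_open_segment)
  qed
  ultimately show False using ext by (auto simp: extreme_point_of_def)
qed

section \<open>The tetrahedron at a degree three vertex\<close>

text \<open>
  For a point \<open>(p, q, r)\<close> of the tetrahedron that is not a corner, \<open>\<alpha> u + \<beta> v + \<gamma> w = 0\<close> is one
  equation that makes a direction \<open>(u, v, w)\<close> preserve the tight inequalities, provided that the
  direction vanishes at the coordinates \<open>\<plusminus>1\<close>. On a side of the tetrahedron two facets meet, but
  there one coordinate is \<open>\<plusminus>1\<close> and both facets give the same equation in the other two
  coordinates, a homogeneous one that the point itself satisfies.
\<close>

lemma tetrahedron_local_equation:
  fixes p q r :: real
  assumes "p + q + r \<le> 1" "p - q - r \<le> 1" "q - p - r \<le> 1" "r - p - q \<le> 1"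
    and "\<not> (\<bar>p\<bar> = 1 \<and> \<bar>q\<bar> = 1 \<and> \<bar>r\<bar> = 1)"
  obtains \<alpha> \<beta> \<gamma> where
    "\<forall>u v w. \<alpha> * u + \<beta> * v + \<gamma> * w = 0 \<longrightarrow>
       (\<bar>p\<bar> = 1 \<longrightarrow> u = 0) \<and> (\<bar>q\<bar> = 1 \<longrightarrow> v = 0) \<and> (\<bar>r\<bar> = 1 \<longrightarrow> w = 0) \<longrightarrow>
       (p + q + r = 1 \<longrightarrow> u + v + w = 0) \<and> (p - q - r = 1 \<longrightarrow> u - v - w = 0) \<and>
       (q - p - r = 1 \<longrightarrow> v - u - w = 0) \<and> (r - p - q = 1 \<longrightarrow> w - u - v = 0)"
    and "\<bar>p\<bar> < 1 \<and> \<bar>q\<bar> < 1 \<and> \<bar>r\<bar> < 1 \<or>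
       \<bar>p\<bar> < 1 \<and> \<bar>q\<bar> < 1 \<and> \<bar>r\<bar> = 1 \<and> \<alpha> * p + \<beta> * q = 0 \<or>
       \<bar>p\<bar> < 1 \<and> \<bar>q\<bar> = 1 \<and> \<bar>r\<bar> < 1 \<and> \<alpha> * p + \<gamma> * r = 0 \<or>
       \<bar>p\<bar> = 1 \<and> \<bar>q\<bar> < 1 \<and> \<bar>r\<bar> < 1 \<and> \<beta> * q + \<gamma> * r = 0"
proof -
  have "\<bar>p\<bar> \<le> 1" "\<bar>q\<bar> \<le> 1" "\<bar>r\<bar> \<le> 1" using assms by linarith+
  then consider "p = 1" | "p = -1" | "q = 1" | "q = -1" | "r = 1" | "r = -1"
    | "\<bar>p\<bar> < 1" "\<bar>q\<bar> < 1" "\<bar>r\<bar> < 1"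
    by linarith
  thus thesis
  proof cases
    case 1
    hence "r = -q" using assms by linarith
    thus ?thesis using 1 assms(5) \<open>\<bar>q\<bar> \<le> 1\<close> by (intro that[of 0 1 1]) auto
  next
    case 2
    hence "r = q" using assms by linarith
    thus ?thesis using 2 assms(5) \<open>\<bar>q\<bar> \<le> 1\<close> by (intro that[of 0 1 "-1"]) auto
  next
    case 3
    hence "r = -p" using assms by linarith
    thus ?thesis using 3 assms(5) \<open>\<bar>p\<bar> \<le> 1\<close> by (intro that[of 1 0 1]) auto
  next
    case 4
    hence "r = p" using assms by linarith
    thus ?thesis using 4 assms(5) \<open>\<bar>p\<bar> \<le> 1\<close> by (intro that[of 1 0 "-1"]) auto
  next
    case 5
    hence "q = -p" using assms by linarith
    thus ?thesis using 5 assms(5) \<open>\<bar>p\<bar> \<le> 1\<close> by (intro that[of 1 1 0]) auto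
  next
    case 6
    hence "q = p" using assms by linarith
    thus ?thesis using 6 assms(5) \<open>\<bar>p\<bar> \<le> 1\<close> by (intro that[of 1 "-1" 0]) auto
  next
    case 7
    \<comment> \<open>Two tight facets would force some coordinate to be \<open>\<plusminus>1\<close>.\<close>
    consider "p + q + r = 1" | "p - q - r = 1" | "q - p - r = 1" | "r - p - q = 1"
      | "p + q + r \<noteq> 1" "p - q - r \<noteq> 1" "q - p - r \<noteq> 1" "r - p - q \<noteq> 1" by blast
    thus ?thesis
    proof cases
      case 1
      hence "p - q - r \<noteq> 1" "q - p - r \<noteq> 1" "r - p - q \<noteq> 1" using 7 by linarith+
      thus ?thesis using 7 by (intro that[of 1 1 1]) auto
    next
      case 2
      hence "p + q + r \<noteq> 1" "q - p - r \<noteq> 1" "r - p - q \<noteq> 1" using 7 by linarith+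
      thus ?thesis using 7 by (intro that[of 1 "-1" "-1"]) auto
    next
      case 3
      hence "p + q + r \<noteq> 1" "p - q - r \<noteq> 1" "r - p - q \<noteq> 1" using 7 by linarith+
      thus ?thesis using 7 by (intro that[of "-1" 1 "-1"]) auto
    next
      case 4
      hence "p + q + r \<noteq> 1" "p - q - r \<noteq> 1" "q - p - r \<noteq> 1" using 7 by linarith+
      thus ?thesis using 7 by (intro that[of "-1" "-1" 1]) auto
    next
      case 5
      thus ?thesis using 7 by (intro that[of 0 0 0]) auto
    qed
  qed
qed

section \<open>The inequalities of the rescaled graph polytope\<close>

text \<open>
  Writing \<open>a - b - c\<close> as \<open>2a - (a + b + c)\<close> expresses the four normals through the multiset of
  incident edges alone, so that no order of the edges has to be chosen and loops need no case
  distinction.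
\<close>

definition vertex_normals :: "('v, 'e::finite) multigraph \<Rightarrow> 'v \<Rightarrow> (real ^ 'e) set" where
  "vertex_normals G v =
     (let n = (\<Sum>e\<in>#incident G v. axis e 1)
      in insert n ((\<lambda>a. 2 *\<^sub>R axis a 1 - n) ` set_mset (incident G v)))"

definition graph_normals :: "('v, 'e::finite) multigraph \<Rightarrow> (real ^ 'e) set" where
  "graph_normals G = (\<Union>v \<in> {v \<in> verts G. vertex_degree G v = 3}. vertex_normals G v)"

lemma vertex_normals_eq:
  fixes G :: "('v, 'e::finite) multigraph"
  assumes "incident G v = {#a, b, c#}"
  shows "vertex_normals G v =
    {axis a 1 + axis b 1 + axis c 1, axis a 1 - axis b 1 - axis c 1,
     axis b 1 - axis a 1 - axis c 1, axis c 1 - axis a 1 - axis b 1}"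
proof -
  have "2 *\<^sub>R u - (u + (v + w)) = u - v - w" "2 *\<^sub>R v - (u + (v + w)) = v - u - w"
    "2 *\<^sub>R w - (u + (v + w)) = w - u - v" for u v w :: "real ^ 'e"
    by (simp_all add: scaleR_2)
  note diffs = this
  have total: "(\<Sum>e\<in>#{#a, b, c#}. axis e (1::real)) = axis a 1 + (axis b 1 + axis c 1)"
    by simp
  show ?thesis
    unfolding vertex_normals_def Let_def assms total
    by (simp only: set_mset_add_mset_insert set_mset_empty image_insert image_empty diffs add.assoc)
qed

lemma in_incident_iff: "e \<in># incident G v \<longleftrightarrow> v \<in># ends G e"
  by (simp add: count_incident flip: count_greater_zero_iff)

lemma incident_three:
  assumes "vertex_degree G v = 3"
  obtains a b c where "incident G v = {#a, b, c#}"
proof -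
  have "size (incident G v) = Suc 2" using assms by (simp add: size_incident)
  moreover from size_eq_Suc_imp_eq_union[OF this] obtain a M where "incident G v = add_mset a M"
    by blast
  ultimately have M: "incident G v = add_mset a M" "size M = 2" by simp_all
  obtain b M' where M': "M = add_mset b M'" "size M' = 1"
    using M(2) size_eq_Suc_imp_eq_union[of M 1] by fastforce
  from size_1_singleton_mset[OF M'(2)] obtain c where "M' = {#c#}" by blast
  thus thesis using M(1) M'(1) that by simp
qed

lemma graph_normals_integral:
  fixes G :: "('v, 'e::finite) multigraph"
  shows "graph_normals G \<subseteq> integer_points"
proof
  fix n assume "n \<in> graph_normals G"
  then obtain v where v: "vertex_degree G v = 3" and n: "n \<in> vertex_normals G v"
    by (auto simp: graph_normals_def)
  obtain a b c where abc: "incident G v = {#a, b, c#}" using v by (rule incident_three)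
  have "axis e (1::real) $ i \<in> \<int>" for e i :: 'e by (simp add: axis_def)
  thus "n \<in> integer_points"
    using n by (auto simp: vertex_normals_eq[OF abc] integer_points_def)
qed

lemma finite_graph_normals: "finite (verts G) \<Longrightarrow> finite (graph_normals G)"
  by (simp add: graph_normals_def vertex_normals_def Let_def)

lemma unit_polyhedron_graph_normals_iff:
  "x \<in> unit_polyhedron (graph_normals G) \<longleftrightarrow>
     (\<forall>v\<in>verts G. vertex_degree G v = 3 \<longrightarrow>
       (\<forall>a b c. incident G v = {#a, b, c#} \<longrightarrow>
          x $ a + x $ b + x $ c \<le> 1 \<and> x $ a - x $ b - x $ c \<le> 1 \<and>
          x $ b - x $ a - x $ c \<le> 1 \<and> x $ c - x $ a - x $ b \<le> 1))"
proof -
  have "(\<forall>n\<in>vertex_normals G v. n \<bullet> x \<le> 1) \<longleftrightarrow>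
     (\<forall>a b c. incident G v = {#a, b, c#} \<longrightarrow>
          x $ a + x $ b + x $ c \<le> 1 \<and> x $ a - x $ b - x $ c \<le> 1 \<and>
          x $ b - x $ a - x $ c \<le> 1 \<and> x $ c - x $ a - x $ b \<le> 1)" (is "?L \<longleftrightarrow> ?R")
    if v: "vertex_degree G v = 3" for v
  proof
    assume ?L
    thus ?R by (auto simp: vertex_normals_eq inner_add_left inner_diff_left inner_axis')
  next
    assume R: ?R
    obtain a b c where "incident G v = {#a, b, c#}" using v by (rule incident_three)
    thus ?L using R
      by (simp add: vertex_normals_eq inner_add_left inner_diff_left inner_axis')
  qed
  thus ?thesis unfolding unit_polyhedron_def graph_normals_def by blast
qed

lemma rescaled_graph_polytope:
  fixes G :: "('v, 'e::finite) multigraph"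
  shows "(\<lambda>w. 4 *\<^sub>R w - vec 1) ` graph_polytope G = unit_polyhedron (graph_normals G)"
proof -
  have mem: "4 *\<^sub>R w - vec 1 \<in> unit_polyhedron (graph_normals G) \<longleftrightarrow> w \<in> graph_polytope G" for w
  proof -
    have "(4 * p - 1) + (4 * q - 1) + (4 * r - 1) \<le> (1::real) \<longleftrightarrow> p + q + r \<le> 1"
      "(4 * p - 1) - (4 * q - 1) - (4 * r - 1) \<le> (1::real) \<longleftrightarrow> p \<le> q + r" for p q r :: real
      by auto
    thus ?thesis
      unfolding unit_polyhedron_graph_normals_iff graph_polytope_def by simp
  qed
  have "x = 4 *\<^sub>R ((1 / 4) *\<^sub>R (x + vec 1)) - vec 1" for x :: "real ^ 'e" by simp
  thus ?thesis using mem by (metis (lifting) image_eqI image_subsetI subsetI subset_antisym)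
qed

lemma abs_le_one_unit_polyhedron:
  assumes cover: "\<forall>e. \<exists>v\<in>verts G. v \<in># ends G e \<and> vertex_degree G v = 3"
    and x: "x \<in> unit_polyhedron (graph_normals G)"
  shows "\<bar>x $ e\<bar> \<le> 1"
proof -
  obtain v where v: "v \<in> verts G" "v \<in># ends G e" "vertex_degree G v = 3" using cover by blast
  obtain a b c where abc: "incident G v = {#a, b, c#}" using v(3) by (rule incident_three)
  have "e \<in># incident G v"
    using v(2) by (simp add: in_incident_iff)
  hence "e \<in> {a, b, c}" by (simp add: abc)
  thus ?thesis
    using x v abc unfolding unit_polyhedron_graph_normals_iff
    by (smt (verit) insert_iff empty_iff)
qed

section \<open>Integrality of the extreme points\<close>

text \<open>
  The vectors orthogonal to all of the axes outside \<open>F\<close> and to the \<open>N v\<close> are the solutions supported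
  on \<open>F\<close> of the equations \<open>N v\<close>; these \<open>CARD('n) - |F| + |W|\<close> vectors do not span.
\<close>

lemma underdetermined_supported_solution:
  fixes N :: "'v \<Rightarrow> real ^ 'n::finite"
  assumes "finite W" "card W < card F"
  obtains d where "d \<noteq> 0" "\<And>e. e \<notin> F \<Longrightarrow> d $ e = 0" "\<And>v. v \<in> W \<Longrightarrow> N v \<bullet> d = 0"
proof -
  define S where "S = (\<lambda>e. axis e (1::real)) ` (- F) \<union> N ` W"
  have "dim S \<le> card S" by (rule dim_le_card') (simp add: S_def assms(1))
  also have "\<dots> \<le> card (- F) + card W"
    unfolding S_def
    by (rule order_trans[OF card_Un_le]) (intro add_mono card_image_le; simp add: assms(1))
  also have "\<dots> < CARD('n)"
    using assms(2) card_mono[of UNIV F] by (simp add: Compl_eq_Diff_UNIV card_Diff_subset)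
  finally have "dim S < DIM(real ^ 'n)" by simp
  from orthogonal_to_subspace_exists[OF this]
  obtain d where d: "d \<noteq> 0" "\<And>y. y \<in> span S \<Longrightarrow> orthogonal d y" by blast
  have "y \<bullet> d = 0" if "y \<in> S" for y
    using d(2)[OF span_base[OF that]] by (simp add: orthogonal_def inner_commute)
  note orth = this
  show thesis
  proof (rule that[OF d(1)])
    fix e assume "e \<notin> F"
    hence "axis e 1 \<bullet> d = 0" by (intro orth) (auto simp: S_def)
    thus "d $ e = 0" by (simp add: inner_axis')
  next
    fix v assume "v \<in> W"
    thus "N v \<bullet> d = 0" by (intro orth) (auto simp: S_def)
  qed
qed

lemma sum_ends_degree:
  assumes "finite_multigraph G"
  shows "(\<Sum>v\<in>verts G. \<Sum>e\<in>F. count (ends G e) v) = 2 * card F"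
proof -
  have "(\<Sum>v\<in>verts G. count (ends G e) v) = 2" for e
    using assms sum.mono_neutral_left[of "verts G" "set_mset (ends G e)" "count (ends G e)"]
    unfolding finite_multigraph_def size_multiset_overloaded_eq
    by (metis (no_types, lifting) DiffE not_in_iff)
  thus ?thesis by (subst sum.swap) simp
qed

text \<open>
  The global form of \<open>tetrahedron_local_equation\<close>. A loop contributes twice both to the equation
  and to the number of ends.
\<close>

lemma vertex_local_equation:
  fixes G :: "('v, 'e::finite) multigraph" and x :: "real ^ 'e"
  defines "F \<equiv> {e. \<bar>x $ e\<bar> < 1}"
  assumes x: "x \<in> unit_polyhedron (graph_normals G)"
    and v: "v \<in> verts G" "vertex_degree G v = 3"
    and F: "\<exists>e\<in>F. e \<in># incident G v"
  obtains N where
    "\<And>d n. \<forall>e. \<bar>x $ e\<bar> = 1 \<longrightarrow> d $ e = 0 \<Longrightarrow> N \<bullet> d = 0 \<Longrightarrow>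
       n \<in> vertex_normals G v \<Longrightarrow> n \<bullet> x = 1 \<Longrightarrow> n \<bullet> d = 0"
    and "(\<Sum>e\<in>F. count (ends G e) v) \<ge> 2"
    and "(\<Sum>e\<in>F. count (ends G e) v) = 2 \<Longrightarrow> N \<bullet> (\<chi> e. if e \<in> F then x $ e else 0) = 0"
proof -
  obtain a b c where abc: "incident G v = {#a, b, c#}" using v(2) by (rule incident_three)
  have ineqs: "x $ a + x $ b + x $ c \<le> 1" "x $ a - x $ b - x $ c \<le> 1"
      "x $ b - x $ a - x $ c \<le> 1" "x $ c - x $ a - x $ b \<le> 1"
    using x v abc unfolding unit_polyhedron_graph_normals_iff by blast+
  have "\<not> (\<bar>x $ a\<bar> = 1 \<and> \<bar>x $ b\<bar> = 1 \<and> \<bar>x $ c\<bar> = 1)"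
    using F by (auto simp: F_def abc)
  then obtain \<alpha> \<beta> \<gamma> where
    eq: "\<forall>u v w. \<alpha> * u + \<beta> * v + \<gamma> * w = 0 \<longrightarrow>
       (\<bar>x $ a\<bar> = 1 \<longrightarrow> u = 0) \<and> (\<bar>x $ b\<bar> = 1 \<longrightarrow> v = 0) \<and> (\<bar>x $ c\<bar> = 1 \<longrightarrow> w = 0) \<longrightarrow>
       (x $ a + x $ b + x $ c = 1 \<longrightarrow> u + v + w = 0) \<and>
       (x $ a - x $ b - x $ c = 1 \<longrightarrow> u - v - w = 0) \<and>
       (x $ b - x $ a - x $ c = 1 \<longrightarrow> v - u - w = 0) \<and>
       (x $ c - x $ a - x $ b = 1 \<longrightarrow> w - u - v = 0)"
    and cases: "\<bar>x $ a\<bar> < 1 \<and> \<bar>x $ b\<bar> < 1 \<and> \<bar>x $ c\<bar> < 1 \<or>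
       \<bar>x $ a\<bar> < 1 \<and> \<bar>x $ b\<bar> < 1 \<and> \<bar>x $ c\<bar> = 1 \<and> \<alpha> * x $ a + \<beta> * x $ b = 0 \<or>
       \<bar>x $ a\<bar> < 1 \<and> \<bar>x $ b\<bar> = 1 \<and> \<bar>x $ c\<bar> < 1 \<and> \<alpha> * x $ a + \<gamma> * x $ c = 0 \<or>
       \<bar>x $ a\<bar> = 1 \<and> \<bar>x $ b\<bar> < 1 \<and> \<bar>x $ c\<bar> < 1 \<and> \<beta> * x $ b + \<gamma> * x $ c = 0"
    by (rule tetrahedron_local_equation[OF ineqs])
  define N where "N = \<alpha> *\<^sub>R axis a 1 + \<beta> *\<^sub>R axis b 1 + \<gamma> *\<^sub>R axis c (1::real)"
  have N: "N \<bullet> d = \<alpha> * d $ a + \<beta> * d $ b + \<gamma> * d $ c" for d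
    by (simp add: N_def inner_add_left inner_axis')
  have mem_F: "e \<in> F \<longleftrightarrow> \<bar>x $ e\<bar> < 1" for e by (simp add: F_def)
  have "(\<Sum>e\<in>F. count (ends G e) v) = size (filter_mset (\<lambda>e. e \<in> F) (incident G v))"
    unfolding size_multiset_overloaded_eq
    by (rule sum.mono_neutral_cong_right) (auto simp: count_incident not_in_iff in_incident_iff)
  hence ends: "(\<Sum>e\<in>F. count (ends G e) v)
      = (if a \<in> F then 1 else 0) + (if b \<in> F then 1 else 0) + (if c \<in> F then 1 else 0)"
    by (simp add: abc)
  show thesis
  proof (rule that[of N])
    fix d n :: "real ^ 'e"
    assume d: "\<forall>e. \<bar>x $ e\<bar> = 1 \<longrightarrow> d $ e = 0" "N \<bullet> d = 0"
      and n: "n \<in> vertex_normals G v" "n \<bullet> x = 1"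
    from eq[rule_format, of "d $ a" "d $ b" "d $ c"] d n show "n \<bullet> d = 0"
      by (auto simp: N vertex_normals_eq[OF abc] inner_add_left inner_diff_left inner_axis')
  next
    show "(\<Sum>e\<in>F. count (ends G e) v) \<ge> 2"
      using cases unfolding ends mem_F by auto
  next
    assume "(\<Sum>e\<in>F. count (ends G e) v) = 2"
    thus "N \<bullet> (\<chi> e. if e \<in> F then x $ e else 0) = 0"
      using cases unfolding ends N mem_F by auto
  qed
qed

text \<open>
  The count of ends: each vertex of \<open>W\<close> imposes one equation and uses up at least two of the
  \<open>2|F|\<close> ends of edges of \<open>F\<close>, so \<open>|W| \<le> |F|\<close>, and equality forces exactly two ends at every
  vertex of \<open>W\<close>. In that extremal case the equations could have only the zero solution in general, for
  instance along a cycle with an odd number of sign changes; it is because \<open>x\<close> itself satisfies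
  them that this does not happen at a point that is not integral.
\<close>

lemma tight_direction:
  fixes G :: "('v, 'e::finite) multigraph"
  assumes G: "finite_multigraph G"
    and x: "x \<in> unit_polyhedron (graph_normals G)" and le1: "\<And>e. \<bar>x $ e\<bar> \<le> 1"
    and nonint: "x \<notin> integer_points"
  obtains d where "d \<noteq> 0" "\<And>n. n \<in> graph_normals G \<Longrightarrow> n \<bullet> x = 1 \<Longrightarrow> n \<bullet> d = 0"
proof -
  define F where "F = {e. \<bar>x $ e\<bar> < 1}"
  define W where "W = {v \<in> verts G. vertex_degree G v = 3 \<and> (\<exists>e\<in>F. e \<in># incident G v)}"
  define h where "h v = (\<Sum>e\<in>F. count (ends G e) v)" for v
  define y where "y = (\<chi> e. if e \<in> F then x $ e else 0)"
  have "finite (verts G)" using G by (simp add: finite_multigraph_def)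
  hence "finite W" by (simp add: W_def)
  have outside: "e \<notin> F \<longleftrightarrow> \<bar>x $ e\<bar> = 1" for e using le1[of e] by (auto simp: F_def)
  have "\<forall>v\<in>W. \<exists>N. (\<forall>d n. (\<forall>e. e \<notin> F \<longrightarrow> d $ e = 0) \<longrightarrow> N \<bullet> d = 0 \<longrightarrow>
       n \<in> vertex_normals G v \<longrightarrow> n \<bullet> x = 1 \<longrightarrow> n \<bullet> d = 0) \<and> h v \<ge> 2 \<and> (h v = 2 \<longrightarrow> N \<bullet> y = 0)"
  proof
    fix v assume "v \<in> W"
    hence "v \<in> verts G" "vertex_degree G v = 3" "\<exists>e\<in>{e. \<bar>x $ e\<bar> < 1}. e \<in># incident G v"
      by (auto simp: W_def F_def)
    from vertex_local_equation[OF x this] show "\<exists>N. (\<forall>d n. (\<forall>e. e \<notin> F \<longrightarrow> d $ e = 0) \<longrightarrow>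
        N \<bullet> d = 0 \<longrightarrow> n \<in> vertex_normals G v \<longrightarrow> n \<bullet> x = 1 \<longrightarrow> n \<bullet> d = 0) \<and> h v \<ge> 2 \<and>
        (h v = 2 \<longrightarrow> N \<bullet> y = 0)"
      unfolding F_def[symmetric] h_def[symmetric] y_def[symmetric] outside by metis
  qed
  then obtain N where
    N: "\<And>v d n. v \<in> W \<Longrightarrow> \<forall>e. e \<notin> F \<longrightarrow> d $ e = 0 \<Longrightarrow> N v \<bullet> d = 0 \<Longrightarrow>
         n \<in> vertex_normals G v \<Longrightarrow> n \<bullet> x = 1 \<Longrightarrow> n \<bullet> d = 0"
    and h2: "\<And>v. v \<in> W \<Longrightarrow> h v \<ge> 2" and Ny: "\<And>v. v \<in> W \<Longrightarrow> h v = 2 \<Longrightarrow> N v \<bullet> y = 0"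
    by metis
  have "\<exists>d. d \<noteq> 0 \<and> (\<forall>e. e \<notin> F \<longrightarrow> d $ e = 0) \<and> (\<forall>v\<in>W. N v \<bullet> d = 0)"
  proof (cases "card W < card F")
    case True
    from underdetermined_supported_solution[OF \<open>finite W\<close> True, of N] show ?thesis by metis
  next
    case False
    \<comment> \<open>Now every vertex of \<open>W\<close> has exactly two ends in \<open>F\<close>, and \<open>y\<close> is a solution.\<close>
    have "(\<Sum>v\<in>W. h v) \<le> (\<Sum>v\<in>verts G. h v)"
      using \<open>finite (verts G)\<close> by (intro sum_mono2) (auto simp: W_def)
    also have "\<dots> = 2 * card F" unfolding h_def by (rule sum_ends_degree[OF G])
    also have "\<dots> \<le> (\<Sum>v\<in>W. 2)" using False by simp
    finally have "(\<Sum>v\<in>W. h v) = (\<Sum>v\<in>W. 2)" using sum_mono[of W "\<lambda>_. 2" h] h2 by simp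
    hence "h v = 2" if "v \<in> W" for v
      using sum_mono_inv[of "\<lambda>_. 2" W h v] h2 that \<open>finite W\<close> by simp
    hence "\<forall>v\<in>W. N v \<bullet> y = 0" using Ny by blast
    moreover have "y \<noteq> 0"
    proof -
      obtain e where e: "x $ e \<notin> \<int>" using nonint by (auto simp: integer_points_def)
      have "e \<in> F"
      proof (rule ccontr)
        assume "e \<notin> F"
        hence "x $ e = 1 \<or> x $ e = -1" using outside by auto
        thus False using e by auto
      qed
      hence "y $ e \<noteq> 0" using e by (auto simp: y_def)
      thus ?thesis by auto
    qed
    ultimately show ?thesis by (intro exI[of _ y]) (simp add: y_def)
  qed
  then obtain d where d: "d \<noteq> 0" "\<forall>e. e \<notin> F \<longrightarrow> d $ e = 0" "\<forall>v\<in>W. N v \<bullet> d = 0" by blast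
  show thesis
  proof (rule that[OF d(1)])
    fix n assume "n \<in> graph_normals G" and tight: "n \<bullet> x = 1"
    then obtain v where v: "v \<in> verts G" "vertex_degree G v = 3" "n \<in> vertex_normals G v"
      by (auto simp: graph_normals_def)
    show "n \<bullet> d = 0"
    proof (cases "v \<in> W")
      case True
      thus ?thesis using N[of v d n] d v(3) tight by blast
    next
      case False
      obtain a b c where abc: "incident G v = {#a, b, c#}" using v(2) by (rule incident_three)
      have "a \<notin> F" "b \<notin> F" "c \<notin> F" using False v by (auto simp: W_def abc)
      hence "d $ a = 0" "d $ b = 0" "d $ c = 0" using d(2) by auto
      thus ?thesis
        using v(3) by (auto simp: vertex_normals_eq[OF abc] inner_add_left inner_diff_left inner_axis')
    qed
  qed
qed

theorem theorem4:
  fixes G :: "('v, 'e::finite) multigraph"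
  assumes "one_three_graph G"
    and "\<forall>e. \<exists>v\<in>verts G. v \<in># ends G e \<and> vertex_degree G v = 3"
  shows "reflexive_polytope ((\<lambda>w. 4 *\<^sub>R w - vec 1) ` graph_polytope G)"
proof -
  let ?Q = "unit_polyhedron (graph_normals G)"
  have G: "finite_multigraph G" using assms(1) by (simp add: one_three_graph_def)
  hence fin: "finite (graph_normals G)"
    by (simp add: finite_graph_normals finite_multigraph_def)
  have le1: "\<bar>x $ e\<bar> \<le> 1" if "x \<in> ?Q" for x e
    using assms(2) that by (rule abs_le_one_unit_polyhedron)
  have "?Q \<subseteq> cbox (- vec 1) (vec 1)"
    using le1 by (auto simp: mem_box_cart abs_le_iff minus_le_iff)
  hence bdd: "bounded ?Q" by (rule bounded_subset[OF bounded_cbox])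
  have "x \<in> integer_points" if ext: "x extreme_point_of ?Q" for x
  proof (rule ccontr)
    assume nonint: "x \<notin> integer_points"
    have x: "x \<in> ?Q" using ext by (simp add: extreme_point_of_def)
    obtain d where "d \<noteq> 0" "\<And>n. n \<in> graph_normals G \<Longrightarrow> n \<bullet> x = 1 \<Longrightarrow> n \<bullet> d = 0"
      using tight_direction[OF G x le1[OF x] nonint] by blast
    thus False using not_extreme_point_if_tight_direction[OF fin x] ext by blast
  qed
  thus ?thesis
    unfolding rescaled_graph_polytope reflexive_polytope_def integral_polytope_def
    using polytope_unit_polyhedron[OF fin bdd] zero_in_interior_unit_polyhedron[OF fin]
      semi_reflexive_unit_polyhedron[OF fin bdd graph_normals_integral]
    by blast
qed

end
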